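(* Let $\triangle PQR$ be a (closed, filled) triangle in $D$ with $d'(P,R)=d'(Q,R)$, $d'(P,Q)>\log 3$ and $\delta(P,Q,R)<\Delta_2'(P,Q)$. Then $\rho(\psi_{\triangle PQR})>\frac{2}{5}$.
   Context: $D$ is the open unit disk in $\mathbb R^2$, $S^1$ its boundary circle identified with $\mathbb R/\mathbb Z$ via the counterclockwise normalized angle. For a closed convex $U\subset D$ and $v\in S^1$, $\psi_U(v)$ is the point $w\in S^1\setminus\{v\}$ such that the line $vw$ meets $U$ and $U$ lies in the closed half-plane to the left of the directed line from $v$ to $w$; it is an orientation-preserving homeomorphism of $S^1$. For such $f$, $\rho(f)=\lim_{n\to\infty}(\overline f^n(x)-x)/n$ with $\overline f$ the lift to $\mathbb R$ satisfying $\overline f(0)\in[0,1)$. Regard $D$ as the Beltrami–Klein model (hyperbolic lines are chords). For distinct $P,Q\in D$ with chord endpoints $v_1,v_2\in S^1$, $d'(P,Q)=\tfrac12\left|\log\frac{|v_1Q||v_2P|}{|v_1P||v_2Q|}\right|$; $\Delta_n'(P,Q)=\log\frac{e^{n d'(P,Q)}+1}{e^{n d'(P,Q)}-1}$ for $n\in\mathbb Z_{>0}$; $\delta(P,Q,R)=\min\{d'(R,S): S \text{ on the chord through } P,Q\}$. *)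

theory Defs
  imports "HOL-Analysis.Analysis"
begin

text \<open>The plane is modelled by the complex numbers; D is the open unit disk,
  S^1 the unit circle, identified with R/Z via t \<mapsto> cis (2 pi t).\<close>

definition diskD :: "complex set" where
  "diskD = ball 0 1"

definition circ :: "real \<Rightarrow> complex" where
  "circ t = cis (2 * pi * t)"

text \<open>Signed cross product: positive iff b lies strictly to the left of a.\<close>
definition cross :: "complex \<Rightarrow> complex \<Rightarrow> real" where
  "cross a b = Im (cnj a * b)"

definition psi :: "complex set \<Rightarrow> complex \<Rightarrow> complex" where
  "psi U v = (THE w. cmod w = 1 \<and> w \<noteq> v \<and>
       (\<exists>u\<in>U. cross (w - v) (u - v) = 0) \<and>
       (\<forall>u\<in>U. cross (w - v) (u - v) \<ge> 0))"

definition circle_lift :: "(complex \<Rightarrow> complex) \<Rightarrow> real \<Rightarrow> real" where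
  "circle_lift f = (THE F. continuous_on UNIV F \<and>
       (\<forall>x. circ (F x) = f (circ x)) \<and> 0 \<le> F 0 \<and> F 0 < 1)"

definition rot_num :: "(complex \<Rightarrow> complex) \<Rightarrow> real" where
  "rot_num f = lim (\<lambda>n. ((circle_lift f ^^ n) 0 - 0) / real n)"

definition chord_ends :: "complex \<Rightarrow> complex \<Rightarrow> complex set" where
  "chord_ends P Q = {v. cmod v = 1 \<and> collinear {P, Q, v}}"

definition dK :: "complex \<Rightarrow> complex \<Rightarrow> real" where
  "dK P Q = (SOME d. \<exists>v1 v2. v1 \<in> chord_ends P Q \<and> v2 \<in> chord_ends P Q \<and> v1 \<noteq> v2 \<and>
      d = \<bar>ln ((cmod (v1 - Q) * cmod (v2 - P)) / (cmod (v1 - P) * cmod (v2 - Q)))\<bar> / 2)"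

definition DeltaK :: "nat \<Rightarrow> complex \<Rightarrow> complex \<Rightarrow> real" where
  "DeltaK n P Q = ln ((exp (real n * dK P Q) + 1) / (exp (real n * dK P Q) - 1))"

definition deltaK :: "complex \<Rightarrow> complex \<Rightarrow> complex \<Rightarrow> real" where
  "deltaK P Q R = Inf {dK R S | S. S \<in> diskD \<and> collinear {P, Q, S}}"

end

theory Submission
  imports Defs
begin

text \<open>
  For a point \<open>X\<close> of the disk the map sending a boundary point to the other end of its chord through
  \<open>X\<close> is the hyperbolic half-turn \<open>\<sigma>\<^sub>X\<close>; let \<open>F\<^sub>X\<close> be its lift with \<open>x < F\<^sub>X x < x + 1\<close>, so that
  \<open>F\<^sub>X (F\<^sub>X x) = x + 1\<close>. The lift of \<open>\<psi>\<close> for the triangle is \<open>F = min F\<^sub>P F\<^sub>Q F\<^sub>R\<close>, and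
  \<open>\<rho> > 2/5\<close> follows from \<open>F\<^sup>5 x > x + 2\<close>, i.e. from \<open>W x > x + 2\<close> for every composition \<open>W\<close> of
  five of the maps \<open>F\<^sub>P, F\<^sub>Q, F\<^sub>R\<close>. This property is invariant under cyclic rotation of the word, and
  two equal adjacent letters cancel to a shift by 1, which leaves the words \<open>ZXYXY\<close> and \<open>ZXY\<close> with
  distinct letters. At an endpoint \<open>a\<close> of the chord \<open>XY\<close> we have \<open>F\<^sub>X (F\<^sub>Y a) = a + 1\<close>, so the
  inequality holds there; by the intermediate value theorem it holds everywhere unless the Moebius map
  \<open>\<sigma>\<^sub>Z (\<sigma>\<^sub>X \<sigma>\<^sub>Y)\<^sup>2\<close> has a boundary fixed point. Its trace shows that it is elliptic as soon as
  \<open>sinh (2 d(X,Y)) sinh h < 1\<close>, where \<open>h\<close> is the distance of \<open>Z\<close> from the line \<open>XY\<close>. For \<open>Z = R\<close> this is the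
  hypothesis on \<open>\<delta>\<close>; since \<open>sinh d(X,Y) sinh h\<close> does not depend on the choice of the base, the other
  two cases follow because the legs are not longer than the base.
\<close>

section \<open>Hyperbolic distance in the Klein model\<close>

text \<open>Up to sign, the Lorentzian inner product of \<open>(X, 1)\<close> and \<open>(Y, 1)\<close>, and the
  determinant of three such vectors.\<close>
definition kform :: "complex \<Rightarrow> complex \<Rightarrow> real" where
  "kform X Y = 1 - Re (X * cnj Y)"

definition kdet :: "complex \<Rightarrow> complex \<Rightarrow> complex \<Rightarrow> real" where
  "kdet X Y Z = cross X Y + cross Y Z + cross Z X"

lemma kform_commute: "kform X Y = kform Y X"
  by (simp add: kform_def)

lemma kform_same: "kform X X = 1 - (cmod X)\<^sup>2"
  by (simp add: kform_def complex_mult_cnj cmod_power2)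

lemma kform_same_pos: "X \<in> diskD \<Longrightarrow> kform X X > 0"
  by (simp add: kform_same diskD_def power_less_one_iff)

lemma kform_pos: assumes "X \<in> diskD" "Y \<in> diskD" shows "kform X Y > 0"
proof -
  have "Re (X * cnj Y) \<le> cmod X * cmod Y"
    by (metis complex_Re_le_cmod complex_mod_cnj norm_mult)
  also have "\<dots> < 1 * 1"
    using assms by (intro mult_strict_mono') (auto simp: diskD_def)
  finally show ?thesis by (simp add: kform_def)
qed

text \<open>Splitting off 1 makes the parameters of the chord ends the roots of the remaining
  quadratic, to which Vieta's formulas apply.\<close>

lemma cmod_line_power2:
  "(cmod (X + of_real s * (Y - X)))\<^sup>2
     = 1 + ((cmod (Y - X))\<^sup>2 * s\<^sup>2 + 2 * (kform X X - kform X Y) * s - kform X X)"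
  unfolding cmod_power2 kform_def by (simp add: power2_eq_square algebra_simps)

lemma chord_endsE:
  assumes "v \<in> chord_ends X Y" "X \<noteq> Y"
  obtains s where "v = X + of_real s * (Y - X)"
    "(cmod (Y - X))\<^sup>2 * s\<^sup>2 + 2 * (kform X X - kform X Y) * s - kform X X = 0"
proof -
  have "collinear {X, v, Y}" and n: "cmod v = 1"
    using assms by (auto simp: chord_ends_def insert_commute)
  then obtain u where u: "v = u *\<^sub>R X + (1 - u) *\<^sub>R Y"
    using assms(2) by (auto simp: collinear_3_expand)
  define s where "s = 1 - u"
  have v: "v = X + of_real s * (Y - X)"
    by (simp add: u s_def scaleR_conv_of_real algebra_simps)
  have "(cmod (X + of_real s * (Y - X)))\<^sup>2 = 1" using n v by simp
  then have "(cmod (Y - X))\<^sup>2 * s\<^sup>2 + 2 * (kform X X - kform X Y) * s - kform X X = 0"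
    by (simp add: cmod_line_power2)
  with v show ?thesis using that by blast
qed

text \<open>The cross ratio equals \<open>x / y\<close> with \<open>x = (s - 1) * t\<close> and
  \<open>y = s * (t - 1)\<close>, where \<open>s\<close>, \<open>t\<close> are the parameters of the
  ends. Vieta expresses \<open>x + y\<close> and \<open>x * y\<close> through \<open>kform\<close>,
  and half the logarithm of \<open>x / y\<close> has squared cosh
  \<open>(x + y)\<^sup>2 / (4 * (x * y))\<close>.\<close>

lemma cosh_chord_ends:
  assumes X: "X \<in> diskD" and Y: "Y \<in> diskD" and "X \<noteq> Y"
    and v: "v1 \<in> chord_ends X Y" "v2 \<in> chord_ends X Y" "v1 \<noteq> v2"
  shows "cosh (\<bar>ln ((cmod (v1 - Y) * cmod (v2 - X)) / (cmod (v1 - X) * cmod (v2 - Y)))\<bar> / 2)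
           = kform X Y / (sqrt (kform X X) * sqrt (kform Y Y))"
proof -
  define L where "L = (cmod (Y - X))\<^sup>2"
  define nX where "nX = kform X X"
  define nY where "nY = kform Y Y"
  define b where "b = kform X Y"
  have Lpos: "L > 0" using assms(3) by (simp add: L_def)
  have npos: "nX > 0" "nY > 0" "b > 0"
    using X Y by (auto simp: nX_def nY_def b_def kform_same_pos kform_pos)
  have Leq: "L = 2 * b - nX - nY"
    unfolding L_def b_def nX_def nY_def kform_def cmod_power2
    by (simp add: power2_eq_square algebra_simps)
  obtain s where s: "v1 = X + of_real s * (Y - X)" "L * s\<^sup>2 + 2 * (nX - b) * s - nX = 0"
    using chord_endsE[OF v(1) assms(3)] unfolding L_def nX_def b_def by metis
  obtain t where t: "v2 = X + of_real t * (Y - X)" "L * t\<^sup>2 + 2 * (nX - b) * t - nX = 0"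
    using chord_endsE[OF v(2) assms(3)] unfolding L_def nX_def b_def by metis
  have st: "s \<noteq> t" using v(3) s t by auto
  have "(s - t) * (L * (s + t) + 2 * (nX - b)) = 0"
    using s(2) t(2) by (simp add: power2_eq_square algebra_simps)
  then have sum: "L * (s + t) = 2 * (b - nX)" using st by simp
  have prod: "L * (s * t) = - nX" using sum s(2) by algebra
  define x where "x = (s - 1) * t"
  define y where "y = s * (t - 1)"
  have xy: "L * x = L * (s * t) - L * t" "L * y = L * (s * t) - L * s"
    by (simp_all add: x_def y_def algebra_simps)
  have add: "L * (x + y) = - 2 * b" using sum prod xy by (simp add: algebra_simps)
  have "L * ((s - 1) * (t - 1)) = L * (s * t) - L * (s + t) + L" by (simp add: algebra_simps)
  then have "L * ((s - 1) * (t - 1)) = - nY" using sum prod Leq by simp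
  then have mult: "L\<^sup>2 * (x * y) = nX * nY"
    using prod unfolding x_def y_def power2_eq_square by algebra
  \<comment> \<open>Both numbers turn out negative, so the absolute values in the cross ratio
    cancel.\<close>
  have "x * y > 0"
    using mult npos Lpos by (metis mult_pos_pos zero_less_mult_pos zero_less_power)
  moreover have "x + y < 0"
    using add npos Lpos by (smt (verit) mult_nonneg_nonneg)
  ultimately have neg: "x < 0" "y < 0"
    by (auto simp: zero_less_mult_iff)
  define r where "r = x / y"
  have rpos: "r > 0" using neg by (simp add: r_def divide_neg_neg)
  have c: "cmod (v1 - X) = \<bar>s\<bar> * cmod (Y - X)" "cmod (v2 - X) = \<bar>t\<bar> * cmod (Y - X)"
    using s t by (simp_all add: norm_mult)
  have "v1 - Y = of_real (s - 1) * (Y - X)" "v2 - Y = of_real (t - 1) * (Y - X)"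
    using s t by (simp_all add: algebra_simps)
  then have c': "cmod (v1 - Y) = \<bar>s - 1\<bar> * cmod (Y - X)" "cmod (v2 - Y) = \<bar>t - 1\<bar> * cmod (Y - X)"
    by (simp_all only: norm_mult norm_of_real)
  have "(cmod (v1 - Y) * cmod (v2 - X)) / (cmod (v1 - X) * cmod (v2 - Y)) = \<bar>x\<bar> / \<bar>y\<bar>"
    using assms(3) unfolding c c' x_def y_def by (simp add: abs_mult)
  also have "\<dots> = r" using neg by (simp add: r_def)
  finally have ratio: "(cmod (v1 - Y) * cmod (v2 - X)) / (cmod (v1 - X) * cmod (v2 - Y)) = r" .
  define d where "d = \<bar>ln r\<bar> / 2"
  have "cosh (2 * d) = cosh (ln r)" by (simp add: d_def abs_if)
  then have "2 * (cosh d)\<^sup>2 - 1 = (r + inverse r) / 2"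
    using rpos by (simp add: cosh_ln_real cosh_double_cosh)
  then have "(cosh d)\<^sup>2 = (x + y)\<^sup>2 / (4 * (x * y))"
    using neg by (simp add: r_def field_simps power2_eq_square)
  also have "\<dots> = (L * (x + y))\<^sup>2 / (4 * (L\<^sup>2 * (x * y)))"
    using Lpos by (simp add: power_mult_distrib)
  also have "\<dots> = (b / (sqrt nX * sqrt nY))\<^sup>2"
    unfolding add mult using npos by (simp add: power_mult_distrib power_divide)
  finally have "cosh d = b / (sqrt nX * sqrt nY)"
    using npos by simp
  then show ?thesis by (simp add: ratio d_def b_def nX_def nY_def)
qed

text \<open>The quadratic formula gives both ends; the discriminant is positive because
  \<open>kform X X > 0\<close> inside the disk.\<close>

lemma chord_ends_two:
  assumes X: "X \<in> diskD" and "X \<noteq> Y"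
  obtains v1 v2 where "v1 \<in> chord_ends X Y" "v2 \<in> chord_ends X Y" "v1 \<noteq> v2"
proof -
  define L where "L = (cmod (Y - X))\<^sup>2"
  define h where "h = kform X X - kform X Y"
  define D where "D = sqrt (h\<^sup>2 + L * kform X X)"
  have L: "L > 0" using assms(2) by (simp add: L_def)
  have "h\<^sup>2 + L * kform X X > 0" using L kform_same_pos[OF X] by (simp add: add_nonneg_pos)
  then have D: "D > 0" "D\<^sup>2 = h\<^sup>2 + L * kform X X" by (simp_all add: D_def)
  \<comment> \<open>\<open>e\<close> is the sign in front of the square root.\<close>
  have *: "X + of_real s * (Y - X) \<in> chord_ends X Y" if "L * s = - h + e * D" "e\<^sup>2 = 1" for s e
  proof -
    have "L * (L * s\<^sup>2 + 2 * h * s - kform X X) = (L * s + h)\<^sup>2 - D\<^sup>2"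
      unfolding D(2) by (simp add: power2_eq_square algebra_simps)
    also have "\<dots> = 0" using that by (simp add: power_mult_distrib)
    finally have "L * s\<^sup>2 + 2 * h * s - kform X X = 0" using L by simp
    then have "(cmod (X + of_real s * (Y - X)))\<^sup>2 = 1"
      by (simp add: L_def h_def cmod_line_power2)
    then have "cmod (X + of_real s * (Y - X)) = 1"
      by (simp add: power2_eq_1_iff) (smt (verit) norm_ge_zero)
    moreover have "collinear {X, X + of_real s * (Y - X), Y}"
      unfolding collinear_3_expand
      by (intro disjI2 exI[of _ "1 - s"]) (simp add: scaleR_conv_of_real algebra_simps)
    ultimately show ?thesis by (simp add: chord_ends_def insert_commute)
  qed
  show ?thesis
  proof (rule that)
    show "X + of_real ((- h + 1 * D) / L) * (Y - X) \<in> chord_ends X Y"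
      using L by (intro *[of _ 1]) auto
    show "X + of_real ((- h + (-1) * D) / L) * (Y - X) \<in> chord_ends X Y"
      using L by (intro *[of _ "-1"]) auto
    have "(- h + 1 * D) / L \<noteq> (- h + (-1) * D) / L" using L D by (simp add: field_simps)
    then show "X + of_real ((- h + 1 * D) / L) * (Y - X) \<noteq> X + of_real ((- h + (-1) * D) / L) * (Y - X)"
      using assms(2) by (simp del: of_real_add of_real_divide of_real_mult of_real_minus of_real_diff)
  qed
qed

text \<open>The choice in \<open>dK\<close> is harmless: a pair of ends exists, and every pair
  yields the same cosh and a nonnegative value.\<close>

lemma
  assumes "X \<in> diskD" "Y \<in> diskD" "X \<noteq> Y"
  shows cosh_dK: "cosh (dK X Y) = kform X Y / (sqrt (kform X X) * sqrt (kform Y Y))"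
    and dK_nonneg: "dK X Y \<ge> 0"
proof -
  obtain v1 v2 where v: "v1 \<in> chord_ends X Y" "v2 \<in> chord_ends X Y" "v1 \<noteq> v2"
    using chord_ends_two[OF assms(1,3)] .
  have "\<exists>v1 v2. v1 \<in> chord_ends X Y \<and> v2 \<in> chord_ends X Y \<and> v1 \<noteq> v2 \<and>
      dK X Y = \<bar>ln ((cmod (v1 - Y) * cmod (v2 - X)) / (cmod (v1 - X) * cmod (v2 - Y)))\<bar> / 2"
    unfolding dK_def by (rule someI_ex) (use v in blast)
  then obtain v1 v2 where v: "v1 \<in> chord_ends X Y" "v2 \<in> chord_ends X Y" "v1 \<noteq> v2"
    and d: "dK X Y = \<bar>ln ((cmod (v1 - Y) * cmod (v2 - X)) / (cmod (v1 - X) * cmod (v2 - Y)))\<bar> / 2"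
    by blast
  show "cosh (dK X Y) = kform X Y / (sqrt (kform X X) * sqrt (kform Y Y))"
    unfolding d by (rule cosh_chord_ends[OF assms v])
  show "dK X Y \<ge> 0" unfolding d by simp
qed

text \<open>The difference of the two sides is the square of the Lorentzian determinant of
  \<open>R\<close>, \<open>S\<close> and the normal vector of the plane spanned by \<open>P\<close> and \<open>Q\<close>.\<close>
lemma kdet_le_height:
  assumes "S = P + of_real s * (Q - P)"
  shows "(kdet P Q R)\<^sup>2 * kform S S
    \<le> ((kform P Q)\<^sup>2 - kform P P * kform Q Q) * ((kform R S)\<^sup>2 - kform R R * kform S S)"
proof -
  obtain a b where P: "P = Complex a b" by (cases P)
  obtain c d where Q: "Q = Complex c d" by (cases Q)
  obtain e f where R: "R = Complex e f" by (cases R)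
  define x where "x = a + s * (c - a)"
  define y where "y = b + s * (d - b)"
  have S: "S = Complex x y" by (simp add: assms P Q x_def y_def complex_eq_iff)
  \<comment> \<open>The line \<open>PQ\<close> has the equation \<open>l * x + m * y = n\<close>,
    and \<open>kdet P Q R\<close> is the defect of this equation at \<open>R\<close>.\<close>
  define l where "l = b - d"
  define m where "m = c - a"
  define n where "n = b * c - a * d"
  have perp: "x * l + y * m = n"
    by (simp add: x_def y_def l_def m_def n_def algebra_simps)
  have 1: "kdet P Q R = l * e + m * f - n"
    by (simp add: kdet_def cross_def P Q R l_def m_def n_def algebra_simps)
  have 2: "(kform P Q)\<^sup>2 - kform P P * kform Q Q = l\<^sup>2 + m\<^sup>2 - n\<^sup>2"
    by (simp add: kform_def P Q l_def m_def n_def power2_eq_square algebra_simps)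
  have 3: "kform S S = 1 - x\<^sup>2 - y\<^sup>2" "kform R S = 1 - e * x - f * y" "kform R R = 1 - e\<^sup>2 - f\<^sup>2"
    by (simp_all add: kform_def R S power2_eq_square)
  have "(l\<^sup>2 + m\<^sup>2 - n\<^sup>2) * ((1 - e * x - f * y)\<^sup>2 - (1 - e\<^sup>2 - f\<^sup>2) * (1 - x\<^sup>2 - y\<^sup>2))
      - (l * e + m * f - n)\<^sup>2 * (1 - x\<^sup>2 - y\<^sup>2)
      = (e * (y * n - m) + f * (l - x * n) + (x * m - y * l))\<^sup>2"
    unfolding perp[symmetric] by algebra
  then show ?thesis unfolding 1 2 3 by (smt (verit) zero_le_power2)
qed

text \<open>The right-hand side is the Gram determinant of the vectors \<open>(P, 1)\<close>,
  \<open>(Q, 1)\<close>, \<open>(R, 1)\<close>. The form has signature (1,2) and determinant 1, so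
  this is the squared determinant of the vectors.\<close>

lemma kdet_gram:
  "(kdet P Q R)\<^sup>2 = kform P P * kform Q Q * kform R R + 2 * kform P Q * kform Q R * kform P R
     - kform P P * (kform Q R)\<^sup>2 - kform Q Q * (kform P R)\<^sup>2 - kform R R * (kform P Q)\<^sup>2"
  by (cases P; cases Q; cases R)
    (simp add: kdet_def kform_def cross_def power2_eq_square algebra_simps)

lemma kdet_rotate: "kdet X Y Z = kdet Y Z X"
  by (simp add: kdet_def)

lemma kdet_swap: "kdet Y X Z = - kdet X Y Z"
  by (simp add: kdet_def cross_def algebra_simps)

section \<open>From the hypotheses on the triangle to polynomial inequalities\<close>

lemma cosh_dK_power2:
  assumes "X \<in> diskD" "Y \<in> diskD" "X \<noteq> Y"
  shows "(kform X Y)\<^sup>2 = (cosh (dK X Y))\<^sup>2 * (kform X X * kform Y Y)"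
  using cosh_dK[OF assms] kform_same_pos[OF assms(1)] kform_same_pos[OF assms(2)]
  by (simp add: power_divide power_mult_distrib)

text \<open>\<open>DeltaK 2 P Q\<close> is the image of \<open>2 * dK P Q\<close> under the
  involution \<open>ln (coth (x / 2))\<close>, which inverts sinh.\<close>

lemma sinh_DeltaK_2:
  assumes "dK P Q > 0"
  shows "sinh (DeltaK 2 P Q) * sinh (2 * dK P Q) = 1"
proof -
  define E where "E = exp (2 * dK P Q)"
  have E: "E > 1" using assms by (simp add: E_def)
  have pos: "(E + 1) / (E - 1) > 0" using E by simp
  have "sinh (DeltaK 2 P Q) = sinh (ln ((E + 1) / (E - 1)))"
    by (simp add: DeltaK_def E_def)
  also have "\<dots> = ((E + 1) / (E - 1) - (E - 1) / (E + 1)) / 2"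
    using pos by (simp add: sinh_ln_real)
  also have "\<dots> = 2 * E / (E\<^sup>2 - 1)"
  proof -
    have "E\<^sup>2 - 1 = (E - 1) * (E + 1)" by (simp add: power2_eq_square algebra_simps)
    moreover have "E - 1 \<noteq> 0" "E + 1 \<noteq> 0" using E by auto
    ultimately show ?thesis by (simp add: divide_simps) (simp add: algebra_simps)
  qed
  finally have 1: "sinh (DeltaK 2 P Q) = 2 * E / (E\<^sup>2 - 1)" .
  have "sinh (2 * dK P Q) = (E - inverse E) / 2"
    by (simp add: sinh_field_def E_def exp_minus)
  also have "\<dots> = (E\<^sup>2 - 1) / (2 * E)"
    using E by (simp add: field_simps power2_eq_square)
  finally have 2: "sinh (2 * dK P Q) = (E\<^sup>2 - 1) / (2 * E)" .
  have "E\<^sup>2 - 1 \<noteq> 0" using E by (simp add: power2_eq_1_iff)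
  then show ?thesis using E unfolding 1 2 by simp
qed

text \<open>The infimum provides a point \<open>S\<close> of the line with \<open>dK R S\<close>
  below the bound, and \<open>kdet_le_height\<close> applies to any such \<open>S\<close>. With
  \<open>c = dK P Q\<close> and \<open>h = dK R S\<close>, the factor
  \<open>4 * (cosh c)\<^sup>2\<close> completes \<open>(sinh c)\<^sup>2 * (sinh h)\<^sup>2\<close>
  to \<open>(sinh (2 * c) * sinh h)\<^sup>2 < 1\<close>.\<close>

lemma kdet_bound_base:
  assumes D: "P \<in> diskD" "Q \<in> diskD" "R \<in> diskD" and ncol: "\<not> collinear {P, Q, R}"
    and pos: "dK P Q > 0" and small: "deltaK P Q R < DeltaK 2 P Q"
  shows "4 * (cosh (dK P Q))\<^sup>2 * (kdet P Q R)\<^sup>2 < kform P P * kform Q Q * kform R R"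
proof -
  have PQ: "P \<noteq> Q" using ncol by auto
  have "{dK R S | S. S \<in> diskD \<and> collinear {P, Q, S}} \<noteq> {}"
    using D(1) by (auto intro!: exI[of _ P] simp: insert_commute)
  then obtain S where S: "S \<in> diskD" "collinear {P, Q, S}" "dK R S < DeltaK 2 P Q"
    using cInf_lessD small unfolding deltaK_def by (smt (verit, best) mem_Collect_eq)
  have RS: "R \<noteq> S" using S(2) ncol by auto
  have "collinear {P, S, Q}" using S(2) by (simp add: insert_commute)
  then obtain u where "S = u *\<^sub>R P + (1 - u) *\<^sub>R Q"
    using PQ by (auto simp: collinear_3_expand)
  then have "S = P + of_real (1 - u) * (Q - P)"
    by (simp add: scaleR_conv_of_real algebra_simps)
  note le = kdet_le_height[OF this, of R]
  define c where "c = dK P Q"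
  define h where "h = dK R S"
  have n: "kform P P > 0" "kform Q Q > 0" "kform R R > 0" "kform S S > 0"
    using D S(1) by (auto simp: kform_same_pos)
  have PQ2: "(kform P Q)\<^sup>2 - kform P P * kform Q Q = (sinh c)\<^sup>2 * (kform P P * kform Q Q)"
    using cosh_dK_power2[OF D(1,2) PQ]
    by (simp add: c_def cosh_square_eq algebra_simps)
  have RS2: "(kform R S)\<^sup>2 - kform R R * kform S S = (sinh h)\<^sup>2 * (kform R R * kform S S)"
    using cosh_dK_power2[OF D(3) S(1) RS]
    by (simp add: h_def cosh_square_eq algebra_simps)
  have "(kdet P Q R)\<^sup>2 * kform S S \<le> ((sinh c)\<^sup>2 * (sinh h)\<^sup>2 * (kform P P * kform Q Q * kform R R)) * kform S S"
    using le unfolding PQ2 RS2 by (simp add: algebra_simps)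
  then have det: "(kdet P Q R)\<^sup>2 \<le> (sinh c)\<^sup>2 * (sinh h)\<^sup>2 * (kform P P * kform Q Q * kform R R)"
    using n(4) by simp
  have h0: "h \<ge> 0" using dK_nonneg[OF D(3) S(1) RS] by (simp add: h_def)
  have "sinh h < sinh (DeltaK 2 P Q)" using S(3) by (simp add: h_def)
  then have "sinh h * sinh (2 * c) < sinh (DeltaK 2 P Q) * sinh (2 * c)"
    using pos by (simp add: c_def)
  then have "sinh h * sinh (2 * c) < 1"
    using sinh_DeltaK_2[OF pos] by (simp add: c_def)
  moreover have "sinh h * sinh (2 * c) \<ge> 0" using h0 pos by (simp add: c_def)
  ultimately have "(sinh h * sinh (2 * c))\<^sup>2 < 1" by (simp add: power_less_one_iff)
  then have lt: "4 * (cosh c)\<^sup>2 * ((sinh c)\<^sup>2 * (sinh h)\<^sup>2) < 1"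
    unfolding sinh_double by (simp add: power_mult_distrib mult.commute mult.left_commute)
  have "4 * (cosh c)\<^sup>2 * (kdet P Q R)\<^sup>2
      \<le> 4 * (cosh c)\<^sup>2 * ((sinh c)\<^sup>2 * (sinh h)\<^sup>2 * (kform P P * kform Q Q * kform R R))"
    using det by (intro mult_left_mono) auto
  also have "\<dots> = 4 * (cosh c)\<^sup>2 * ((sinh c)\<^sup>2 * (sinh h)\<^sup>2) * (kform P P * kform Q Q * kform R R)"
    by (simp add: mult.assoc)
  also have "\<dots> < 1 * (kform P P * kform Q Q * kform R R)"
    using lt n by (intro mult_strict_right_mono) auto
  finally show ?thesis by (simp add: c_def)
qed

text \<open>Legs longer than a base exceeding \<open>ln 3\<close> would make the Gram determinant
  too large for the bound \<open>det\<close>.\<close>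

lemma isosceles_leg_le_base:
  assumes D: "P \<in> diskD" "Q \<in> diskD" "R \<in> diskD" and ne: "P \<noteq> Q" "P \<noteq> R" "Q \<noteq> R"
    and iso: "dK P R = dK Q R" and base: "dK P Q > ln 3"
    and det: "4 * (cosh (dK P Q))\<^sup>2 * (kdet P Q R)\<^sup>2 < kform P P * kform Q Q * kform R R"
  shows "(cosh (dK P R))\<^sup>2 \<le> (cosh (dK P Q))\<^sup>2"
proof (rule ccontr)
  define C where "C = cosh (dK P Q)"
  define A where "A = cosh (dK P R)"
  assume "\<not> ?thesis"
  then have AC: "C\<^sup>2 < A\<^sup>2" unfolding A_def C_def by (rule not_le_imp_less)
  \<comment> \<open>The threshold \<open>ln 3\<close> enters only through its cosh.\<close>
  have "cosh (ln 3 :: real) = 5 / 3" by (simp add: cosh_ln_real)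
  moreover have "cosh (ln 3) < C"
    unfolding C_def using base by (intro cosh_real_strict_mono) auto
  ultimately have C: "C > 5 / 3" by simp
  define p where "p = sqrt (kform P P)"
  define q where "q = sqrt (kform Q Q)"
  define r where "r = sqrt (kform R R)"
  have n: "kform P P = p\<^sup>2" "kform Q Q = q\<^sup>2" "kform R R = r\<^sup>2" and pos: "p > 0" "q > 0" "r > 0"
    using D by (auto simp: p_def q_def r_def kform_same_pos less_imp_le)
  have "C = kform P Q / (p * q)" "A = kform P R / (p * r)" "A = kform Q R / (q * r)"
    unfolding A_def C_def p_def q_def r_def
    using cosh_dK[OF D(1,2) ne(1)] cosh_dK[OF D(1,3) ne(2)] cosh_dK[OF D(2,3) ne(3)] iso by simp_all
  then have B: "kform P Q = C * (p * q)" "kform P R = A * (p * r)" "kform Q R = A * (q * r)"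
    using pos by (metis nonzero_divide_eq_eq mult_pos_pos less_irrefl)+
  define N where "N = (p * q * r)\<^sup>2"
  have N: "N > 0" using pos by (simp add: N_def)
  \<comment> \<open>Normalizing the vectors leaves a Gram matrix with diagonal 1 and off-diagonal
    entries \<open>C\<close>, \<open>A\<close>, \<open>A\<close>, whose determinant factors.\<close>
  have gram: "(kdet P Q R)\<^sup>2 = ((C - 1) * (2 * A\<^sup>2 - C - 1)) * N"
    unfolding kdet_gram n B N_def by (simp add: power2_eq_square algebra_simps)
  have "4 * C\<^sup>2 * (kdet P Q R)\<^sup>2 < N"
    using det unfolding n C_def[symmetric] by (simp add: N_def power_mult_distrib)
  then have "(4 * C\<^sup>2 * ((C - 1) * (2 * A\<^sup>2 - C - 1))) * N < 1 * N"
    unfolding gram by (simp only: mult.assoc mult_1_left)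
  then have lt: "4 * C\<^sup>2 * ((C - 1) * (2 * A\<^sup>2 - C - 1)) < 1"
    using N by (simp only: mult_less_cancel_right_pos)
  have "(5/3)\<^sup>2 \<le> C\<^sup>2" using C by (intro power_mono) auto
  then have C2: "C\<^sup>2 \<ge> 25/9" by (simp add: power2_eq_square)
  have "C * C \<ge> (5/3) * C" using C by (intro mult_right_mono) auto
  then have "2 * A\<^sup>2 - C - 1 \<ge> 2" using AC C unfolding power2_eq_square by linarith
  then have k: "(2/3) * 2 \<le> (C - 1) * (2 * A\<^sup>2 - C - 1)"
    using C by (intro mult_mono) auto
  \<comment> \<open>The left side is 400/27, far above the bound 1.\<close>
  have "4 * (25/9) * ((2/3) * 2) \<le> 4 * C\<^sup>2 * ((C - 1) * (2 * A\<^sup>2 - C - 1))"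
    by (rule mult_mono[OF _ k]) (use C2 in auto)
  with lt show False by simp
qed

text \<open>Equivalent to \<open>sinh (2 * d(X,Y)) * sinh h < 1\<close>, where \<open>h\<close> is the hyperbolic distance
  from \<open>Z\<close> to the line \<open>XY\<close>.\<close>
definition small_triangle :: "complex \<Rightarrow> complex \<Rightarrow> complex \<Rightarrow> bool" where
  "small_triangle X Y Z \<longleftrightarrow>
     4 * (kform X Y)\<^sup>2 * (kdet X Y Z)\<^sup>2 < (kform X X)\<^sup>2 * (kform Y Y)\<^sup>2 * kform Z Z"

lemma small_triangle_swap: "small_triangle X Y Z \<longleftrightarrow> small_triangle Y X Z"
  by (simp add: small_triangle_def kdet_swap[of Y X] kform_commute[of Y X] mult.commute)

lemma small_triangleI:
  assumes "X \<in> diskD" "Y \<in> diskD" "X \<noteq> Y"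
    and "4 * (cosh (dK X Y))\<^sup>2 * (kdet X Y Z)\<^sup>2 < kform X X * kform Y Y * kform Z Z"
  shows "small_triangle X Y Z"
proof -
  have n: "kform X X * kform Y Y > 0" using assms by (simp add: kform_same_pos)
  have "(kform X X * kform Y Y) * (4 * (cosh (dK X Y))\<^sup>2 * (kdet X Y Z)\<^sup>2)
      < (kform X X * kform Y Y) * (kform X X * kform Y Y * kform Z Z)"
    using assms(4) n by (rule mult_strict_left_mono)
  then show ?thesis unfolding small_triangle_def cosh_dK_power2[OF assms(1-3)]
    by (simp add: power2_eq_square algebra_simps)
qed

text \<open>\<open>(kdet P Q R)\<^sup>2\<close> and the product of the three norms are symmetric in
  the vertices, so changing the base changes only the cosh factor.\<close>

lemma small_triangle_all:
  assumes D: "P \<in> diskD" "Q \<in> diskD" "R \<in> diskD" and ncol: "\<not> collinear {P, Q, R}"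
    and iso: "dK P R = dK Q R" and base: "dK P Q > ln 3"
    and small: "deltaK P Q R < DeltaK 2 P Q"
  shows "small_triangle P Q R" "small_triangle P R Q" "small_triangle Q R P"
proof -
  have ne: "P \<noteq> Q" "P \<noteq> R" "Q \<noteq> R" using ncol by (auto simp: insert_commute)
  have "dK P Q > 0" using base ln_gt_zero[of "3::real"] by linarith
  note b = kdet_bound_base[OF D ncol this small]
  then show "small_triangle P Q R" by (rule small_triangleI[OF D(1,2) ne(1)])
  note leg = isosceles_leg_le_base[OF D ne iso base b]
  have "4 * (cosh (dK P R))\<^sup>2 * (kdet P Q R)\<^sup>2 \<le> 4 * (cosh (dK P Q))\<^sup>2 * (kdet P Q R)\<^sup>2"
    using leg by (intro mult_right_mono) auto
  with b have b': "4 * (cosh (dK P R))\<^sup>2 * (kdet P Q R)\<^sup>2 < kform P P * kform Q Q * kform R R"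
    by linarith
  have "(kdet P R Q)\<^sup>2 = (kdet P Q R)\<^sup>2" by (simp add: kdet_rotate[of P R Q] kdet_swap[of R Q] kdet_rotate[of P Q R])
  with b' show "small_triangle P R Q" by (intro small_triangleI[OF D(1,3) ne(2)]) (simp add: algebra_simps)
  from b' show "small_triangle Q R P"
    by (intro small_triangleI[OF D(2,3) ne(3)]) (simp add: iso kdet_rotate[of P Q R] algebra_simps)
qed

section \<open>Half-turns on the circle at infinity\<close>

lemma circ_add: "circ (x + y) = circ x * circ y"
  by (simp add: circ_def cis_mult algebra_simps)

lemma circ_minus: "circ (- x) = cnj (circ x)"
  by (simp add: circ_def cis_cnj)

lemma norm_circ [simp]: "cmod (circ x) = 1"
  by (simp add: circ_def)

lemma circ_of_int [simp]: "circ (of_int k) = 1"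
  by (simp add: circ_def)

lemma circ_plus_1 [simp]: "circ (x + 1) = circ x"
  using circ_of_int[of 1] by (simp add: circ_add)

lemma circ_eq_iff: "circ x = circ y \<longleftrightarrow> (\<exists>k::int. x = y + of_int k)"
proof
  assume "circ x = circ y"
  then have "exp (\<i> * of_real (2 * pi * x)) = exp (\<i> * of_real (2 * pi * y))"
    by (simp add: circ_def cis_conv_exp)
  then obtain k :: int where "\<i> * of_real (2 * pi * x) = \<i> * of_real (2 * pi * y) + (of_int (2 * k) * pi) * \<i>"
    by (auto simp: exp_eq)
  then have "Im (\<i> * of_real (2 * pi * x)) = Im (\<i> * of_real (2 * pi * y) + (of_int (2 * k) * pi) * \<i>)"
    by (rule arg_cong)
  then have "2 * pi * x = 2 * pi * (y + of_int k)" by (simp add: algebra_simps)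
  then have "x = y + of_int k" by simp
  then show "\<exists>k::int. x = y + of_int k" ..
qed (auto simp: circ_add)

lemma continuous_on_circ [continuous_intros]: "continuous_on S f \<Longrightarrow> continuous_on S (\<lambda>x. circ (f x))"
  unfolding circ_def by (intro continuous_intros)

lemma circ_diff: "circ t - circ x = (2 * sin (pi * (t - x))) *\<^sub>R (\<i> * cis (pi * (t + x)))"
proof -
  have "cis (2 * pi * t) = cis (pi * (t + x)) * cis (pi * (t - x))"
    "cis (2 * pi * x) = cis (pi * (t + x)) * cis (- (pi * (t - x)))"
    by (simp_all add: cis_mult algebra_simps)
  then have "circ t - circ x = cis (pi * (t + x)) * (cis (pi * (t - x)) - cis (- (pi * (t - x))))"
    unfolding circ_def by (simp only: right_diff_distrib)
  also have "cis (pi * (t - x)) - cis (- (pi * (t - x))) = (2 * sin (pi * (t - x))) *\<^sub>R \<i>"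
    unfolding complex_eq_iff by simp
  finally show ?thesis by (simp add: mult.commute)
qed

text \<open>Each chord is twice a sine times a unit vector at the mean angle. If \<open>t\<close>
  and \<open>s\<close> lie strictly between \<open>x\<close> and \<open>x + 1\<close>, the first two
  sines are positive and the last one decides the sign.\<close>

lemma cross_circ:
  "cross (circ t - circ x) (circ s - circ x)
    = 4 * (sin (pi * (t - x)) * sin (pi * (s - x))) * sin (pi * (s - t))"
proof -
  have "cnj (\<i> * cis (pi * (t + x))) * (\<i> * cis (pi * (s + x))) = cis (pi * (s - t))"
    by (simp add: cis_cnj cis_mult algebra_simps)
  then have "cnj (circ t - circ x) * (circ s - circ x)
      = (4 * (sin (pi * (t - x)) * sin (pi * (s - x)))) *\<^sub>R cis (pi * (s - t))"
    unfolding circ_diff by (simp add: scaleR_conv_of_real algebra_simps)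
  then show ?thesis by (simp add: cross_def)
qed

text \<open>Closed form of the second end of the chord through \<open>v\<close> and \<open>X\<close>
  for \<open>v\<close> on the circle; collinearity is the equation \<open>key\<close> in
  \<open>sgn_cross_turn_lift\<close>.\<close>

definition half_turn :: "complex \<Rightarrow> complex \<Rightarrow> complex" where
  "half_turn X v = (v - X) / (cnj X * v - 1)"

text \<open>For \<open>v\<close> on the circle, \<open>half_turn X v = - v * u / cnj u\<close> with \<open>u = 1 - X * cnj v\<close>.\<close>
definition turn_lift :: "complex \<Rightarrow> real \<Rightarrow> real" where
  "turn_lift X x = x + 1 / 2 + Im (Ln (1 - X * circ (- x))) / pi"

lemma norm_mult_unit_less:
  assumes "X \<in> diskD" "cmod v = 1" shows "cmod (X * v) < 1"
  using assms by (simp add: diskD_def norm_mult)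

lemma Re_one_minus_pos:
  assumes "X \<in> diskD" "cmod v = 1" shows "Re (1 - X * v) > 0"
  using norm_mult_unit_less[OF assms] complex_Re_le_cmod[of "X * v"] by simp

lemma half_turn_denom:
  assumes "X \<in> diskD" "cmod v = 1" shows "cnj X * v \<noteq> 1"
  using norm_mult_unit_less[of "cnj X" v] assms by (auto simp: diskD_def)

text \<open>\<open>1 - X * circ (- x)\<close> lies in the right half-plane, so its argument is less
  than \<open>pi / 2\<close> in absolute value.\<close>

lemma turn_lift_bounds:
  assumes "X \<in> diskD" shows "x < turn_lift X x" "turn_lift X x < x + 1"
proof -
  let ?u = "1 - X * circ (- x)"
  have u: "Re ?u > 0" using assms by (rule Re_one_minus_pos) simp
  then have "?u \<noteq> 0" by force
  with u have "\<bar>Im (Ln ?u)\<bar> < pi / 2" using Re_Ln_pos_lt by blast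
  then have "\<bar>Im (Ln (1 - X * circ (- x))) / pi\<bar> < 1 / 2"
    by (simp add: field_simps)
  then show "x < turn_lift X x" "turn_lift X x < x + 1"
    unfolding turn_lift_def by linarith+
qed

lemma turn_lift_plus_1 [simp]: "turn_lift X (x + 1) = turn_lift X x + 1"
  using circ_plus_1[of "- x - 1"] by (simp add: turn_lift_def)

lemma continuous_on_turn_lift:
  assumes "X \<in> diskD" shows "continuous_on UNIV (turn_lift X)"
proof -
  have "1 - X * circ (- x) \<notin> \<real>\<^sub>\<le>\<^sub>0" for x
    using Re_one_minus_pos[OF assms, of "circ (- x)"] by (auto simp: complex_nonpos_Reals_iff)
  then show ?thesis
    unfolding turn_lift_def by (intro continuous_intros) auto
qed

lemma circ_turn_lift:
  assumes "X \<in> diskD" shows "circ (turn_lift X x) = half_turn X (circ x)"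
proof -
  define v where "v = circ x"
  define u where "u = 1 - X * cnj v"
  have v: "v * cnj v = 1" by (simp add: v_def complex_norm_square[symmetric])
  have u0: "u \<noteq> 0" using Re_one_minus_pos[OF assms, of "cnj v"] unfolding u_def v_def by force
  have "circ (turn_lift X x) = v * circ (1/2) * cis (2 * Im (Ln u))"
    by (simp add: turn_lift_def circ_add v_def u_def circ_minus) (simp add: circ_def)
  also have "circ (1/2) = -1" by (simp add: circ_def)
  also have "cis (2 * Im (Ln u)) = u / cnj u"
  proof -
    have eu: "exp (Ln u) = u" using u0 by simp
    have "u / cnj u = exp (Ln u) / cnj (exp (Ln u))" using eu by simp
    also have "\<dots> = exp (Ln u - cnj (Ln u))" by (simp add: exp_diff exp_cnj)
    also have "Ln u - cnj (Ln u) = \<i> * of_real (2 * Im (Ln u))" by (simp add: complex_eq_iff)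
    finally show ?thesis by (simp add: cis_conv_exp)
  qed
  also have "v * - 1 * (u / cnj u) = half_turn X v"
  proof -
    have "v * u = v - X" using v by (simp add: u_def algebra_simps)
    moreover have "cnj u = - (cnj X * v - 1)" by (simp add: u_def)
    ultimately have "v * - 1 * (u / cnj u) = - (v - X) / - (cnj X * v - 1)" by simp
    then show ?thesis unfolding half_turn_def minus_divide_divide .
  qed
  finally show ?thesis by (simp add: v_def)
qed

lemma norm_half_turn:
  assumes "X \<in> diskD" "cmod v = 1" shows "cmod (half_turn X v) = 1"
proof -
  have "cnj v * v = 1" using assms(2) complex_norm_square[of v] by (simp add: mult.commute)
  then have "cnj X * v - 1 = - (cnj (v - X) * v)" by (simp add: algebra_simps)
  then have "cmod (cnj X * v - 1) = cmod (v - X)"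
    using assms(2) by (metis complex_mod_cnj mult.right_neutral norm_minus_cancel norm_mult)
  moreover have "cmod (cnj X * v - 1) \<noteq> 0" using half_turn_denom[OF assms] by simp
  ultimately show ?thesis by (simp add: half_turn_def norm_divide)
qed

lemma half_turn_half_turn:
  assumes "X \<in> diskD" "cmod v = 1" shows "half_turn X (half_turn X v) = v"
proof -
  define w where "w = half_turn X v"
  have d: "cnj X * v - 1 \<noteq> 0" and e: "cnj X * w - 1 \<noteq> 0"
    using assms by (auto simp: w_def half_turn_denom norm_half_turn)
  have "w * (cnj X * v - 1) = v - X" using d by (simp add: w_def half_turn_def)
  then have "w - X = v * (cnj X * w - 1)" by (simp add: algebra_simps)
  then show ?thesis using e by (simp add: half_turn_def[of X w] flip: w_def)
qed

text \<open>The half-turn is an involution, so the lift applied twice is an integer shift; two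
  displacements strictly between 0 and 1 leave only 1.\<close>

lemma turn_lift_twice [simp]:
  assumes "X \<in> diskD" shows "turn_lift X (turn_lift X x) = x + 1"
proof -
  have "circ (turn_lift X (turn_lift X x)) = circ x"
    using assms by (simp add: circ_turn_lift half_turn_half_turn)
  then obtain k :: int where k: "turn_lift X (turn_lift X x) = x + of_int k"
    by (auto simp: circ_eq_iff)
  moreover have "0 < real_of_int k" "real_of_int k < 2"
    using turn_lift_bounds[OF assms, of x] turn_lift_bounds[OF assms, of "turn_lift X x"] k by linarith+
  then have "k = 1" by linarith
  ultimately show ?thesis by simp
qed

text \<open>Injectivity follows from \<open>turn_lift_twice\<close>, and a continuous injection is
  monotone; since the value grows by \<open>n\<close> from \<open>x\<close> to \<open>x + n\<close>,
  it is increasing.\<close>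

lemma strict_mono_turn_lift:
  assumes "X \<in> diskD" shows "strict_mono (turn_lift X)"
proof -
  have inj: "inj (turn_lift X)"
    using turn_lift_twice[OF assms] by (metis add_right_cancel injI)
  show ?thesis
  proof (rule strict_monoI)
    fix x y :: real assume "x < y"
    define n where "n = nat \<lceil>y - x\<rceil> + 1"
    have shift: "turn_lift X (x + real n) = turn_lift X x + real n" for n
      by (induction n) (simp_all add: add.assoc[symmetric] add.commute[of 1])
    have "y < x + real n" unfolding n_def by linarith
    with \<open>x < y\<close> have "(turn_lift X x < turn_lift X y \<and> turn_lift X y < turn_lift X (x + real n)) \<or>
        (turn_lift X (x + real n) < turn_lift X y \<and> turn_lift X y < turn_lift X x)"
      by (intro continuous_inj_imp_mono)
        (auto intro: continuous_on_subset[OF continuous_on_turn_lift[OF assms]] inj_on_subset[OF inj])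
    then show "turn_lift X x < turn_lift X y" unfolding shift by linarith
  qed
qed

text \<open>\<open>X\<close> lies between \<open>v\<close> and the other end \<open>w\<close> of its
  chord, so replacing \<open>X\<close> by \<open>w\<close> rescales the cross product by a positive
  factor, and \<open>cross_circ\<close> gives its sign.\<close>

lemma sgn_cross_turn_lift:
  assumes X: "X \<in> diskD" and t: "x < t" "t < x + 1"
  shows "sgn (cross (circ t - circ x) (X - circ x)) = sgn (turn_lift X x - t)"
proof -
  define v where "v = circ x"
  define w where "w = circ (turn_lift X x)"
  have v: "v * cnj v = 1" by (simp add: v_def complex_norm_square[symmetric])
  have den: "cnj X * v - 1 \<noteq> 0" using X by (simp add: half_turn_denom v_def)
  have w: "w * (cnj X * v - 1) = v - X"
    using den X by (simp add: w_def circ_turn_lift half_turn_def v_def)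
  define a where "a = (cmod (v - X))\<^sup>2"
  define b where "b = kform X X"
  have "v \<noteq> X" using X by (auto simp: v_def diskD_def)
  then have ab: "a > 0" "b > 0" using X by (auto simp: a_def b_def kform_same_pos)
  \<comment> \<open>The factor \<open>v\<close> is inserted so that \<open>v * cnj v = 1\<close>
    removes the conjugates.\<close>
  have key: "of_real a * (w - X) = - of_real b * (v - X)"
  proof -
    have a: "of_real a = (v - X) * cnj (v - X)" unfolding a_def complex_norm_square ..
    have b: "of_real b = 1 - X * cnj X" unfolding b_def kform_same of_real_diff complex_norm_square by simp
    have vc: "v * cnj (v - X) = - (cnj X * v - 1)" using v by (simp add: algebra_simps)
    have "v * (of_real a * (w - X)) = (v - X) * (v * cnj (v - X)) * (w - X)"
      unfolding a by (simp only: mult_ac)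
    also have "\<dots> = - (v - X) * (w * (cnj X * v - 1) - X * (cnj X * v - 1))"
      unfolding vc by (simp add: algebra_simps)
    also have "\<dots> = v * (- of_real b * (v - X))"
      unfolding w b by (simp add: algebra_simps)
    finally have "v * (of_real a * (w - X)) = v * (- of_real b * (v - X))" .
    moreover have "v \<noteq> 0" using v by auto
    ultimately show ?thesis using mult_left_cancel by blast
  qed
  then have "of_real (a + b) * (X - v) = of_real a * (w - v)" by (simp add: algebra_simps)
  then have "(a + b) *\<^sub>R (X - v) = a *\<^sub>R (w - v)" by (simp only: scaleR_conv_of_real)
  then have "(1 / (a + b)) *\<^sub>R ((a + b) *\<^sub>R (X - v)) = (1 / (a + b)) *\<^sub>R (a *\<^sub>R (w - v))"
    by (rule arg_cong)
  then have "X - v = (a / (a + b)) *\<^sub>R (w - v)"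
    using ab by simp
  then have "cross (circ t - v) (X - v) = (a / (a + b)) * cross (circ t - v) (w - v)"
    by (simp add: cross_def)
  then have "sgn (cross (circ t - v) (X - v)) = sgn (cross (circ t - v) (w - v))"
    using ab by (simp add: sgn_mult)
  also have "\<dots> = sgn (sin (pi * (turn_lift X x - t)))"
  proof -
    have "sin (pi * (t - x)) > 0" "sin (pi * (turn_lift X x - x)) > 0"
      using t turn_lift_bounds[OF X, of x] by (auto intro!: sin_gt_zero)
    then show ?thesis unfolding w_def v_def cross_circ by (simp add: sgn_mult)
  qed
  \<comment> \<open>The difference lies strictly between -1 and 1, where sine of its multiple by pi
    keeps its sign.\<close>
  also have "\<dots> = sgn (turn_lift X x - t)"
  proof -
    let ?s = "turn_lift X x - t"
    have s: "\<bar>?s\<bar> < 1" using t turn_lift_bounds[OF X, of x] by linarith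
    consider "?s = 0" | "?s > 0" | "?s < 0" by linarith
    then show ?thesis
    proof cases
      case 2
      then have "sin (pi * ?s) > 0" using s by (intro sin_gt_zero) auto
      with 2 show ?thesis by simp
    next
      case 3
      then have "sin (pi * (t - turn_lift X x)) > 0" using s by (intro sin_gt_zero) auto
      moreover have "pi * ?s = - (pi * (t - turn_lift X x))" by (simp add: algebra_simps)
      ultimately have "sin (pi * ?s) < 0" by (simp only: sin_minus neg_less_0_iff_less)
      with 3 show ?thesis by simp
    qed simp
  qed
  finally show ?thesis by (simp add: v_def)
qed

section \<open>The support map of a triangle\<close>

definition tri_lift :: "complex \<Rightarrow> complex \<Rightarrow> complex \<Rightarrow> real \<Rightarrow> real" where
  "tri_lift P Q R x = min (turn_lift P x) (min (turn_lift Q x) (turn_lift R x))"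

lemma tri_lift_le: "X \<in> {P, Q, R} \<Longrightarrow> tri_lift P Q R x \<le> turn_lift X x"
  by (auto simp: tri_lift_def)

lemma tri_lift_eq: "\<exists>X\<in>{P, Q, R}. tri_lift P Q R x = turn_lift X x"
  by (auto simp: tri_lift_def min_def)

lemma circ_ex:
  assumes "cmod w = 1" "w \<noteq> circ x"
  obtains t where "x < t" "t < x + 1" "w = circ t"
proof -
  define s where "s = Arg w / (2 * pi)"
  have "w \<noteq> 0" using assms(1) by auto
  then have s: "circ s = w"
    using assms(1) by (simp add: circ_def s_def cis_Arg sgn_eq)
  define t where "t = s - of_int \<lfloor>s - x\<rfloor>"
  have t: "w = circ t"
    using circ_of_int[of "- \<lfloor>s - x\<rfloor>"] circ_add[of s "of_int (- \<lfloor>s - x\<rfloor>)"] by (simp add: t_def s)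
  have "x \<le> t" "t < x + 1" unfolding t_def by linarith+
  moreover have "t \<noteq> x" using t assms(2) by auto
  ultimately show ?thesis using that t by force
qed

lemma cross_affine: "cross a (u *\<^sub>R x + v *\<^sub>R y - b) = u * cross a (x - b) + v * cross a (y - b)"
  if "u + v = 1"
proof -
  have "u *\<^sub>R (x - b) + v *\<^sub>R (y - b) = u *\<^sub>R x + v *\<^sub>R y - (u + v) *\<^sub>R b"
    by (simp add: algebra_simps)
  then have eq: "u *\<^sub>R x + v *\<^sub>R y - b = u *\<^sub>R (x - b) + v *\<^sub>R (y - b)"
    using that by simp
  show ?thesis unfolding eq by (simp add: cross_def algebra_simps)
qed

lemma convex_cross_ge: "convex {u. cross a (u - b) \<ge> 0}"
  by (rule convexI) (simp add: cross_affine)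

lemma convex_cross_gt: "convex {u. cross a (u - b) > 0}"
proof (rule convexI)
  fix x y and u v :: real
  assume "x \<in> {u. cross a (u - b) > 0}" "y \<in> {u. cross a (u - b) > 0}" "0 \<le> u" "0 \<le> v" "u + v = 1"
  then show "u *\<^sub>R x + v *\<^sub>R y \<in> {u. cross a (u - b) > 0}"
    using convex_bound_lt[of "- cross a (x - b)" 0 "- cross a (y - b)" u v]
    by (simp add: cross_affine)
qed

text \<open>A vertex \<open>X\<close> is weakly left of the line from \<open>circ x\<close> to
  \<open>circ t\<close> iff \<open>t \<le> turn_lift X x\<close>, and strictly left iff the
  inequality is strict. Half-planes are convex, so the hull is on the left for \<open>t\<close> up
  to the minimum and touches the line only there.\<close>

lemma psi_triangle:
  assumes D: "P \<in> diskD" "Q \<in> diskD" "R \<in> diskD"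
  shows "psi (convex hull {P, Q, R}) (circ x) = circ (tri_lift P Q R x)"
proof -
  let ?U = "convex hull {P, Q, R}" and ?F = "tri_lift P Q R x"
  have disk: "X \<in> diskD" if "X \<in> {P, Q, R}" for X using that D by auto
  have F: "x < ?F" "?F < x + 1"
    using turn_lift_bounds[OF D(1), of x] turn_lift_bounds[OF D(2), of x]
      turn_lift_bounds[OF D(3), of x] by (auto simp: tri_lift_def)
  have ge: "cross (circ t - circ x) (X - circ x) \<ge> 0 \<longleftrightarrow> t \<le> turn_lift X x"
    and gt: "cross (circ t - circ x) (X - circ x) > 0 \<longleftrightarrow> t < turn_lift X x"
    if "X \<in> {P, Q, R}" "x < t" "t < x + 1" for X t
    using sgn_cross_turn_lift[OF disk[OF that(1)] that(2,3)]
    by (auto simp: sgn_if split: if_splits)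
  show ?thesis unfolding psi_def
  proof (rule the_equality, intro conjI)
    show "circ ?F \<noteq> circ x"
    proof
      assume "circ ?F = circ x"
      then obtain k :: int where "?F = x + of_int k" by (auto simp: circ_eq_iff)
      then have "0 < k" "k < 1" using F by linarith+
      then show False by simp
    qed
    obtain X where X: "X \<in> {P, Q, R}" "?F = turn_lift X x" using tri_lift_eq[of P Q R x] by blast
    have "cross (circ ?F - circ x) (X - circ x) = 0"
      using ge[OF X(1) F] gt[OF X(1) F] X(2) by linarith
    moreover have "X \<in> ?U" using X(1) by (rule hull_inc)
    ultimately show "\<exists>u\<in>?U. cross (circ ?F - circ x) (u - circ x) = 0" by blast
    have "?U \<subseteq> {u. cross (circ ?F - circ x) (u - circ x) \<ge> 0}"
      by (rule hull_minimal) (use ge[OF _ F] tri_lift_le[of _ P Q R x] convex_cross_ge in auto)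
    then show "\<forall>u\<in>?U. cross (circ ?F - circ x) (u - circ x) \<ge> 0" by blast
  next
    fix w
    assume w: "cmod w = 1 \<and> w \<noteq> circ x \<and> (\<exists>u\<in>?U. cross (w - circ x) (u - circ x) = 0) \<and>
       (\<forall>u\<in>?U. cross (w - circ x) (u - circ x) \<ge> 0)"
    then obtain t where t: "x < t" "t < x + 1" "w = circ t"
      using circ_ex by metis
    have "t \<le> turn_lift X x" if "X \<in> {P, Q, R}" for X
      using ge[OF that t(1,2)] w t(3) hull_inc[OF that] by blast
    then have "t \<le> ?F" using tri_lift_eq[of P Q R x] by metis
    moreover have "\<not> t < ?F"
    proof
      assume "t < ?F"
      then have "cross (w - circ x) (X - circ x) > 0" if "X \<in> {P, Q, R}" for X
        using gt[OF that t(1,2)] tri_lift_le[OF that, of x] t(3) by simp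
      then have "?U \<subseteq> {u. cross (w - circ x) (u - circ x) > 0}"
        by (intro hull_minimal convex_cross_gt) auto
      then show False using w by fastforce
    qed
    ultimately show "w = circ ?F" using t(3) by simp
  qed simp
qed

section \<open>Lifts and rotation numbers\<close>

text \<open>Two lifts differ by a continuous integer-valued function, hence by a constant, which the
  normalization at 0 makes zero.\<close>

lemma circle_lift_unique:
  assumes cont: "continuous_on UNIV F" and F: "\<And>x. circ (F x) = f (circ x)" and "0 \<le> F 0" "F 0 < 1"
  shows "circle_lift f = F"
  unfolding circle_lift_def
proof (rule the_equality)
  fix G assume G: "continuous_on UNIV G \<and> (\<forall>x. circ (G x) = f (circ x)) \<and> 0 \<le> G 0 \<and> G 0 < 1"
  have int: "G x - F x \<in> \<int>" for x
  proof -
    have "circ (G x) = circ (F x)" using G F by simp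
    then show ?thesis by (auto simp: circ_eq_iff)
  qed
  have "(\<lambda>x. G x - F x) constant_on UNIV"
  proof (rule continuous_discrete_range_constant)
    show "continuous_on UNIV (\<lambda>x. G x - F x)" using G cont by (intro continuous_intros) auto
    show "\<exists>e>0. \<forall>y. y \<in> UNIV \<and> G y - F y \<noteq> G x - F x \<longrightarrow> e \<le> norm (G y - F y - (G x - F x))" for x
    proof (intro exI[of _ 1] conjI allI impI)
      fix y assume "y \<in> UNIV \<and> G y - F y \<noteq> G x - F x"
      then have "G y - F y - (G x - F x) \<noteq> 0" by auto
      moreover have "G y - F y - (G x - F x) \<in> \<int>" by (rule Ints_diff[OF int int])
      ultimately show "1 \<le> norm (G y - F y - (G x - F x))" by (simp add: Ints_nonzero_abs_ge1)
    qed simp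
  qed auto
  then obtain c where c: "\<And>x. G x - F x = c" by (auto simp: constant_on_def)
  have "c \<in> \<int>" using int[of 0] c by simp
  moreover have "\<bar>c\<bar> < 1" using c[of 0] G assms(3,4) by linarith
  ultimately have "c = 0" using Ints_nonzero_abs_less1 by blast
  then show "G = F" using c by (auto simp: fun_eq_iff)
qed (use assms in auto)

lemma funpow_int_shift:
  fixes F :: "real \<Rightarrow> real"
  assumes "\<And>x. F (x + 1) = F x + 1"
  shows "(F ^^ n) (x + of_int k) = (F ^^ n) x + of_int k"
proof -
  have nat: "F (x + real j) = F x + real j" for x j
    by (induction j) (simp_all add: assms add.assoc[symmetric] add.commute[of 1])
  have F: "F (x + of_int k) = F x + of_int k" for x
  proof (cases "k \<ge> 0")
    case True
    then show ?thesis using nat[of x "nat k"] by simp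
  next
    case False
    then show ?thesis using nat[of "x + of_int k" "nat (- k)"] by simp
  qed
  show ?thesis by (induction n) (simp_all add: F)
qed

text \<open>The iterates of a lift are additive up to an error of 1, which makes
  \<open>F ^^ n / n\<close> a Cauchy sequence.\<close>
lemma convergent_rotation:
  fixes F :: "real \<Rightarrow> real"
  assumes mono: "mono F" and shift: "\<And>x. F (x + 1) = F x + 1"
  shows "convergent (\<lambda>n. (F ^^ n) 0 / real n)"
proof -
  define a where "a n = (F ^^ n) 0" for n
  have mn: "mono (F ^^ n)" for n using mono by (rule mono_pow)
  have dev: "\<bar>(F ^^ n) x - x - a n\<bar> \<le> 1" for n x
  proof -
    have "(F ^^ n) (of_int \<lfloor>x\<rfloor>) \<le> (F ^^ n) x" "(F ^^ n) x \<le> (F ^^ n) (of_int (\<lfloor>x\<rfloor> + 1))"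
      using monoD[OF mn] by simp_all
    moreover have "(F ^^ n) (of_int k) = a n + of_int k" for k :: int
      using funpow_int_shift[of F n 0 k, OF shift] by (simp add: a_def)
    ultimately show ?thesis by (simp only:) (simp, linarith)
  qed
  have mult: "\<bar>a (m * n) - real m * a n\<bar> \<le> real m" for m n
  proof (induction m)
    case (Suc m)
    have "a (Suc m * n) = (F ^^ n) (a (m * n))" by (simp add: a_def funpow_add)
    then show ?case using dev[of n "a (m * n)"] Suc.IH by (simp add: algebra_simps)
  qed (simp add: a_def)
  \<comment> \<open>Two indices \<open>m\<close>, \<open>n\<close> are compared through the common
    multiple \<open>m * n\<close>, at a cost of at most \<open>1 / n\<close> and
    \<open>1 / m\<close>.\<close>
  have close: "\<bar>a (m * n) / real (m * n) - a n / real n\<bar> \<le> 1 / real n" if "m > 0" "n > 0" for m n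
  proof -
    have "a (m * n) / real (m * n) - a n / real n = (a (m * n) - real m * a n) / real (m * n)"
      using that by (simp add: field_simps)
    then have "\<bar>a (m * n) / real (m * n) - a n / real n\<bar> = \<bar>a (m * n) - real m * a n\<bar> / real (m * n)"
      by simp
    also have "\<dots> \<le> real m / real (m * n)" by (intro divide_right_mono mult) simp
    also have "\<dots> = 1 / real n" using that by simp
    finally show ?thesis .
  qed
  have "Cauchy (\<lambda>n. a n / real n)"
  proof (rule CauchyI)
    fix e :: real assume e: "e > 0"
    obtain N where N: "real N > 2 / e" using reals_Archimedean2 by blast
    have Npos: "real N > 0" using N e by (smt (verit) divide_pos_pos)
    show "\<exists>M. \<forall>m\<ge>M. \<forall>n\<ge>M. norm (a m / real m - a n / real n) < e"
    proof (intro exI[of _ N] allI impI)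
      fix m n assume mn: "N \<le> m" "N \<le> n"
      then have pos: "m > 0" "n > 0" using Npos by auto
      have le: "1 / real m \<le> 1 / real N" "1 / real n \<le> 1 / real N"
        using mn Npos by (simp_all add: frac_le)
      have "2 * (1 / real N) < e" using N e Npos by (simp add: field_simps)
      then show "norm (a m / real m - a n / real n) < e"
        using close[OF pos] close[OF pos(2,1)] le unfolding real_norm_def mult.commute[of n m]
        by linarith
    qed
  qed
  then show ?thesis by (simp add: a_def real_Cauchy_convergent)
qed

text \<open>Compactness of a period turns the pointwise inequality into a uniform gain
  \<open>e > p\<close> per \<open>q\<close> steps; the multiples of \<open>q\<close> then bound the
  limit below by \<open>e / q\<close>.\<close>

lemma rotation_gt:
  fixes F :: "real \<Rightarrow> real"
  assumes mono: "mono F" and shift: "\<And>x. F (x + 1) = F x + 1" and cont: "continuous_on UNIV F"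
    and q: "q > 0" and gt: "\<And>x. (F ^^ q) x > x + p"
  shows "lim (\<lambda>n. (F ^^ n) 0 / real n) > p / real q"
proof -
  have contq: "continuous_on UNIV (F ^^ q)"
  proof (induction q)
    case (Suc q)
    then show ?case
      using continuous_on_compose[of UNIV "F ^^ q" F] continuous_on_subset[OF cont]
      by (auto simp: o_def)
  qed (simp add: id_def)
  have "\<exists>x\<in>{0..1}. \<forall>y\<in>{0..1}. (F ^^ q) x - x \<le> (F ^^ q) y - y"
    by (intro continuous_attains_inf continuous_on_diff continuous_on_subset[OF contq]) auto
  then obtain z where z: "\<And>y. y \<in> {0..1} \<Longrightarrow> (F ^^ q) z - z \<le> (F ^^ q) y - y" by blast
  define e where "e = (F ^^ q) z - z"
  have e: "e > p" using gt[of z] by (simp add: e_def)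
  have step: "(F ^^ q) x \<ge> x + e" for x
  proof -
    have "(F ^^ q) (frac x) - frac x \<ge> e" unfolding e_def
      by (rule z) (simp add: frac_lt_1 less_imp_le)
    moreover have "(F ^^ q) x = (F ^^ q) (frac x) + of_int \<lfloor>x\<rfloor>"
      using funpow_int_shift[of F q "frac x" "\<lfloor>x\<rfloor>", OF shift] by (simp add: frac_def)
    ultimately show ?thesis by (simp add: frac_def)
  qed
  have it: "(F ^^ (q * k)) 0 \<ge> real k * e" for k
  proof (induction k)
    case (Suc k)
    have "(F ^^ (q * Suc k)) 0 = (F ^^ q) ((F ^^ (q * k)) 0)" by (simp add: funpow_add)
    then show ?case using step[of "(F ^^ (q * k)) 0"] Suc.IH by (simp add: algebra_simps)
  qed simp
  let ?a = "\<lambda>n. (F ^^ n) 0 / real n"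
  have "?a \<longlonglongrightarrow> lim ?a"
    by (rule convergent_rotation[of F, OF mono shift, unfolded convergent_LIMSEQ_iff])
  \<comment> \<open>\<open>Suc k\<close> avoids the index 0, where the quotient has the default
    value 0.\<close>
  moreover have "strict_mono (\<lambda>k. q * Suc k)" using q by (intro strict_monoI) simp
  ultimately have "(?a \<circ> (\<lambda>k. q * Suc k)) \<longlonglongrightarrow> lim ?a"
    by (rule LIMSEQ_subseq_LIMSEQ)
  moreover have "?a (q * Suc k) \<ge> e / real q" for k
  proof -
    have "e / real q = real (Suc k) * e / real (q * Suc k)" unfolding of_nat_mult using q by (simp del: of_nat_Suc)
    also have "\<dots> \<le> ?a (q * Suc k)" by (intro divide_right_mono it) simp
    finally show ?thesis .
  qed
  ultimately have "e / real q \<le> lim ?a" by (intro LIMSEQ_le_const) (auto simp: o_def)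
  moreover have "p / real q < e / real q" using e q by (simp add: divide_strict_right_mono)
  ultimately show ?thesis by linarith
qed

section \<open>Words in half-turns\<close>

text \<open>\<open>moebius \<alpha> \<beta> v w\<close> states that the matrix with rows \<open>(\<alpha>, \<beta>)\<close> and
  \<open>(cnj \<beta>, cnj \<alpha>)\<close> sends \<open>v\<close> to \<open>w\<close>; clearing the denominator makes composition unconditional.\<close>
definition moebius :: "complex \<Rightarrow> complex \<Rightarrow> complex \<Rightarrow> complex \<Rightarrow> bool" where
  "moebius \<alpha> \<beta> v w \<longleftrightarrow> \<alpha> * v + \<beta> = w * (cnj \<beta> * v + cnj \<alpha>)"

text \<open>Multiplying numerator and denominator by \<open>\<i>\<close> gives the matrix the
  required conjugate symmetry, with trace 0 and determinant \<open>kform X X\<close>.\<close>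

lemma moebius_half_turn:
  assumes "X \<in> diskD" "cmod v = 1"
  shows "moebius \<i> (- \<i> * X) v (half_turn X v)"
proof -
  have "half_turn X v * (cnj X * v - 1) = v - X"
    using half_turn_denom[OF assms] by (simp add: half_turn_def)
  then have "\<i> * (half_turn X v * (cnj X * v - 1)) = \<i> * (v - X)" by simp
  then show ?thesis by (simp add: moebius_def algebra_simps)
qed

lemma moebius_compose:
  assumes "moebius \<alpha> \<beta> v w" "moebius \<gamma> \<delta> w u"
  shows "moebius (\<gamma> * \<alpha> + \<delta> * cnj \<beta>) (\<gamma> * \<beta> + \<delta> * cnj \<alpha>) v u"
proof -
  define m where "m = cnj \<beta> * v + cnj \<alpha>"
  have 1: "\<alpha> * v + \<beta> = w * m" using assms(1) by (simp add: moebius_def m_def)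
  have 2: "\<gamma> * w + \<delta> = u * (cnj \<delta> * w + cnj \<gamma>)" using assms(2) by (simp add: moebius_def)
  have "(\<gamma> * \<alpha> + \<delta> * cnj \<beta>) * v + (\<gamma> * \<beta> + \<delta> * cnj \<alpha>) = \<gamma> * (\<alpha> * v + \<beta>) + \<delta> * m"
    by (simp add: m_def algebra_simps)
  also have "\<dots> = m * (\<gamma> * w + \<delta>)" unfolding 1 by (simp add: algebra_simps)
  also have "\<dots> = u * (cnj \<delta> * (\<alpha> * v + \<beta>) + cnj \<gamma> * m)" unfolding 1 2 by (simp add: algebra_simps)
  finally show ?thesis by (simp add: moebius_def m_def algebra_simps)
qed

text \<open>Multiplicativity of the determinant
  \<open>(cmod \<alpha>)\<^sup>2 - (cmod \<beta>)\<^sup>2\<close>.\<close>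

lemma moebius_det_compose:
  "(cmod (\<gamma> * \<alpha> + \<delta> * cnj \<beta>))\<^sup>2 - (cmod (\<gamma> * \<beta> + \<delta> * cnj \<alpha>))\<^sup>2
    = ((cmod \<gamma>)\<^sup>2 - (cmod \<delta>)\<^sup>2) * ((cmod \<alpha>)\<^sup>2 - (cmod \<beta>)\<^sup>2)"
  unfolding cmod_power2 by (simp add: power2_eq_square algebra_simps)

text \<open>This says that the matrix is not elliptic. The imaginary part of the fixed-point
  equation, multiplied by \<open>cnj v\<close>, gives
  \<open>Im \<alpha> = Im (cnj \<beta> * v)\<close>, hence
  \<open>\<bar>Im \<alpha>\<bar> \<le> cmod \<beta>\<close>.\<close>

lemma moebius_fixpoint:
  assumes "moebius \<alpha> \<beta> v v" "cmod v = 1"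
  shows "(cmod \<alpha>)\<^sup>2 - (cmod \<beta>)\<^sup>2 \<le> (Re \<alpha>)\<^sup>2"
proof -
  have v: "v * cnj v = 1" using assms(2) complex_norm_square[of v] by simp
  have "cnj v * (\<alpha> * v + \<beta>) = cnj v * (v * (cnj \<beta> * v + cnj \<alpha>))"
    using assms(1) by (simp add: moebius_def)
  then have "\<alpha> * (v * cnj v) + \<beta> * cnj v = (v * cnj v) * (cnj \<beta> * v + cnj \<alpha>)"
    by (simp add: algebra_simps)
  then have "Im (\<alpha> + \<beta> * cnj v) = Im (cnj \<beta> * v + cnj \<alpha>)" using v by simp
  then have "Im \<alpha> = Im (cnj \<beta> * v)" by (simp add: algebra_simps)
  then have "\<bar>Im \<alpha>\<bar> \<le> cmod (cnj \<beta> * v)" using abs_Im_le_cmod by metis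
  then have "\<bar>Im \<alpha>\<bar> \<le> cmod \<beta>" using assms(2) by (simp add: norm_mult)
  then have "(Im \<alpha>)\<^sup>2 \<le> (cmod \<beta>)\<^sup>2" using abs_le_square_iff by fastforce
  then show ?thesis by (simp add: cmod_power2[of \<alpha>])
qed

text \<open>Half the trace is \<open>kdet X Y Z\<close> for the short word and
  \<open>- 2 * kform X Y * kdet X Y Z\<close> for the long one. For the latter,
  \<open>small_triangle\<close> is exactly ellipticity; the short word follows from
  \<open>kform X X * kform Y Y \<le> (kform X Y)\<^sup>2\<close>.\<close>

lemma half_turns_no_fixpoint:
  assumes D: "X \<in> diskD" "Y \<in> diskD" "Z \<in> diskD" and ne: "X \<noteq> Y"
    and small: "small_triangle X Y Z" and v: "cmod v = 1"
  shows "half_turn Z (half_turn X (half_turn Y v)) \<noteq> v"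
    and "half_turn Z (half_turn X (half_turn Y (half_turn X (half_turn Y v)))) \<noteq> v"
proof -
  define \<gamma> where "\<gamma> = \<i> * \<i> + (- \<i> * X) * cnj (- \<i> * Y)"
  define \<delta> where "\<delta> = \<i> * (- \<i> * Y) + (- \<i> * X) * cnj \<i>"
  have T: "moebius \<gamma> \<delta> w (half_turn X (half_turn Y w))" if "cmod w = 1" for w
    unfolding \<gamma>_def \<delta>_def using that D
    by (intro moebius_compose[of _ _ _ "half_turn Y w"] moebius_half_turn norm_half_turn)
  have unit: "cmod (half_turn X (half_turn Y w)) = 1" if "cmod w = 1" for w
    using that D by (intro norm_half_turn)
  have det1: "(cmod \<i>)\<^sup>2 - (cmod (- \<i> * W))\<^sup>2 = kform W W" for W
    by (simp add: kform_same norm_mult)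
  have det2: "(cmod \<gamma>)\<^sup>2 - (cmod \<delta>)\<^sup>2 = kform X X * kform Y Y"
    unfolding \<gamma>_def \<delta>_def moebius_det_compose det1 ..
  have Re\<gamma>: "Re \<gamma> = - kform X Y" by (simp add: \<gamma>_def kform_def)
  have kdet: "- Im \<gamma> + Im (Z * cnj \<delta>) = kdet X Y Z"
    by (simp add: \<gamma>_def \<delta>_def kdet_def cross_def algebra_simps)
  have n: "kform X X > 0" "kform Y Y > 0" "kform Z Z > 0" using D by (auto simp: kform_same_pos)
  show "half_turn Z (half_turn X (half_turn Y v)) \<noteq> v"
  proof
    assume *: "half_turn Z (half_turn X (half_turn Y v)) = v"
    have "moebius (\<i> * \<gamma> + (- \<i> * Z) * cnj \<delta>) (\<i> * \<delta> + (- \<i> * Z) * cnj \<gamma>) v v"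
      using moebius_compose[OF T[OF v] moebius_half_turn[OF D(3) unit[OF v]]] unfolding * .
    from moebius_fixpoint[OF this v] have "kform Z Z * (kform X X * kform Y Y) \<le> (kdet X Y Z)\<^sup>2"
      unfolding moebius_det_compose det1 det2 kdet[symmetric] by (simp add: algebra_simps)
    moreover have "4 * (kform X X * kform Y Y) * (kdet X Y Z)\<^sup>2 \<le> 4 * (kform X Y)\<^sup>2 * (kdet X Y Z)\<^sup>2"
    proof -
      have "1 \<le> (cosh (dK X Y))\<^sup>2" using cosh_real_ge_1 by simp
      then have "kform X X * kform Y Y \<le> (kform X Y)\<^sup>2"
        unfolding cosh_dK_power2[OF D(1,2) ne] using n by simp
      then show ?thesis by (intro mult_right_mono) auto
    qed
    ultimately have "4 * (kform X X * kform Y Y) * (kform Z Z * (kform X X * kform Y Y))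
        \<le> 4 * (kform X Y)\<^sup>2 * (kdet X Y Z)\<^sup>2"
      using n by (elim order_trans[OF mult_left_mono]) auto
    also have "\<dots> < (kform X X * kform Y Y) * (kform Z Z * (kform X X * kform Y Y))"
      using small by (simp add: small_triangle_def power2_eq_square mult_ac)
    finally show False using n by (simp add: zero_less_mult_iff)
  qed
  show "half_turn Z (half_turn X (half_turn Y (half_turn X (half_turn Y v)))) \<noteq> v"
  proof
    let ?\<gamma> = "\<gamma> * \<gamma> + \<delta> * cnj \<delta>" and ?\<delta> = "\<gamma> * \<delta> + \<delta> * cnj \<gamma>"
    assume *: "half_turn Z (half_turn X (half_turn Y (half_turn X (half_turn Y v)))) = v"
    have "moebius (\<i> * ?\<gamma> + (- \<i> * Z) * cnj ?\<delta>) (\<i> * ?\<delta> + (- \<i> * Z) * cnj ?\<gamma>) v v"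
      using moebius_compose[OF moebius_compose[OF T[OF v] T[OF unit[OF v]]]
          moebius_half_turn[OF D(3) unit[OF unit[OF v]]]] unfolding * .
    from moebius_fixpoint[OF this v]
    have "kform Z Z * ((kform X X * kform Y Y) * (kform X X * kform Y Y))
        \<le> (Re (\<i> * ?\<gamma> + (- \<i> * Z) * cnj ?\<delta>))\<^sup>2"
      unfolding moebius_det_compose det1 det2 .
    \<comment> \<open>By Cayley-Hamilton the square of the matrix of \<open>XY\<close> is its trace
      times itself minus a scalar matrix; the scalar part contributes nothing because the matrix of
      \<open>Z\<close> has trace 0.\<close>
    also have "Re (\<i> * ?\<gamma> + (- \<i> * Z) * cnj ?\<delta>) = 2 * Re \<gamma> * (- Im \<gamma> + Im (Z * cnj \<delta>))"
      by (simp add: algebra_simps)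
    also have "(2 * Re \<gamma> * (- Im \<gamma> + Im (Z * cnj \<delta>)))\<^sup>2 = 4 * (kform X Y)\<^sup>2 * (kdet X Y Z)\<^sup>2"
      unfolding kdet Re\<gamma> by (simp add: power_mult_distrib)
    finally show False
      using small by (simp add: small_triangle_def power2_eq_square mult_ac)
  qed
qed

text \<open>At an endpoint of the chord through \<open>X\<close> and \<open>Y\<close> the two half-turns agree.\<close>
lemma turn_lift_coincide:
  assumes D: "X \<in> diskD" "Y \<in> diskD"
  obtains a where "turn_lift X a = turn_lift Y a"
proof -
  let ?g = "\<lambda>x. turn_lift X x - turn_lift Y x"
  have "connected (range ?g)"
    using D by (intro connected_continuous_image continuous_intros continuous_on_turn_lift) auto
  \<comment> \<open>If one lift were everywhere larger, its square would be larger too, but both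
    squares are the shift by 1.\<close>
  moreover have "\<exists>x. ?g x \<le> 0"
  proof (rule ccontr)
    assume "\<not> ?thesis"
    then have less: "turn_lift Y x < turn_lift X x" for x by (simp add: not_le)
    have "turn_lift Y (turn_lift Y 0) < turn_lift Y (turn_lift X 0)"
      using strict_mono_turn_lift[OF D(2)] less by (simp add: strict_mono_less)
    also have "\<dots> < turn_lift X (turn_lift X 0)" by (rule less)
    finally show False using D by simp
  qed
  moreover have "\<exists>x. ?g x \<ge> 0"
  proof (rule ccontr)
    assume "\<not> ?thesis"
    then have less: "turn_lift X x < turn_lift Y x" for x by (simp add: not_le)
    have "turn_lift X (turn_lift X 0) < turn_lift X (turn_lift Y 0)"
      using strict_mono_turn_lift[OF D(1)] less by (simp add: strict_mono_less)
    also have "\<dots> < turn_lift Y (turn_lift Y 0)" by (rule less)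
    finally show False using D by simp
  qed
  ultimately have "0 \<in> range ?g" by (meson connectedD_interval rangeI)
  then show ?thesis using that by auto
qed

text \<open>The displacement exceeds \<open>n\<close> at \<open>a\<close> and cannot cross
  \<open>n\<close>, as an integer displacement would be a fixed point on the circle.\<close>

lemma displacement_gt_if_no_fixpoint:
  fixes G :: "real \<Rightarrow> real"
  assumes cont: "continuous_on UNIV G" and a: "G a > a + real n"
    and nofix: "\<And>x. circ (G x) \<noteq> circ x"
  shows "G x > x + real n"
proof (rule ccontr)
  let ?g = "\<lambda>x. G x - x"
  assume "\<not> ?thesis"
  then have "?g x \<le> real n" "real n \<le> ?g a" using a by auto
  moreover have "connected (range ?g)"
    using cont by (intro connected_continuous_image continuous_intros) auto
  ultimately have "real n \<in> range ?g" by (meson connectedD_interval rangeI)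
  then obtain y where "G y = y + of_int (int n)" by (auto simp: algebra_simps)
  then have "circ (G y) = circ y" unfolding circ_eq_iff by blast
  with nofix show False by blast
qed

section \<open>Displacement of words\<close>

definition advances :: "nat \<Rightarrow> complex list \<Rightarrow> bool" where
  "advances k w \<longleftrightarrow> (\<forall>x. x + real k < foldr turn_lift w x)"

text \<open>The hypothesis is used at \<open>turn_lift X x\<close>; the outer
  \<open>turn_lift X\<close> commutes with integer shifts and cancels by strict
  monotonicity.\<close>

lemma advances_rotate:
  assumes "X \<in> diskD" "advances k (X # w)" shows "advances k (w @ [X])"
  unfolding advances_def
proof
  fix x
  have "turn_lift X (x + real k) = turn_lift X x + real k"
    by (induction k) (simp_all add: add.assoc[symmetric] add.commute[of 1])
  also have "\<dots> < turn_lift X (foldr turn_lift w (turn_lift X x))"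
    using assms(2) by (simp add: advances_def)
  finally show "x + real k < foldr turn_lift (w @ [X]) x"
    using strict_mono_turn_lift[OF assms(1)] by (simp add: strict_mono_less)
qed

lemma advances_cancel:
  assumes "X \<in> diskD" "advances k w" shows "advances (Suc k) (X # X # w)"
  using assms by (simp add: advances_def add.assoc[symmetric] add.commute[of 1])

lemma advances_single: "X \<in> diskD \<Longrightarrow> advances 0 [X]"
  by (simp add: advances_def turn_lift_bounds)

lemma advances_alternating:
  assumes D: "X \<in> diskD" "Y \<in> diskD" "Z \<in> diskD" and ne: "X \<noteq> Y"
    and small: "small_triangle X Y Z"
  shows "advances 1 [Z, X, Y]" and "advances 2 [Z, X, Y, X, Y]"
proof -
  obtain a where a: "turn_lift X a = turn_lift Y a" using turn_lift_coincide[OF D(1,2)] .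
  \<comment> \<open>At \<open>a\<close> the inner \<open>turn_lift Y\<close> may be replaced by
    \<open>turn_lift X\<close>.\<close>
  have XY: "turn_lift X (turn_lift Y a) = a + 1" using D a by (metis turn_lift_twice)
  have circ: "circ (turn_lift W x) = half_turn W (circ x)" if "W \<in> {X, Y, Z}" for W x
    using that D by (auto simp: circ_turn_lift)
  note cont = continuous_on_compose2[OF continuous_on_turn_lift[OF D(1)]]
    continuous_on_compose2[OF continuous_on_turn_lift[OF D(2)]]
    continuous_on_compose2[OF continuous_on_turn_lift[OF D(3)]]
  show "advances 1 [Z, X, Y]"
    unfolding advances_def
  proof
    fix x
    show "x + real 1 < foldr turn_lift [Z, X, Y] x"
    proof (rule displacement_gt_if_no_fixpoint[where a = a])
      show "continuous_on UNIV (foldr turn_lift [Z, X, Y])"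
        by (auto simp: o_def intro!: cont continuous_on_turn_lift D)
      show "a + real 1 < foldr turn_lift [Z, X, Y] a"
        using turn_lift_bounds(1)[OF D(3), of "a + 1"] by (simp add: XY)
      show "circ (foldr turn_lift [Z, X, Y] x) \<noteq> circ x" for x
        using half_turns_no_fixpoint(1)[OF D ne small] by (simp add: circ)
    qed
  qed
  show "advances 2 [Z, X, Y, X, Y]"
    unfolding advances_def
  proof
    fix x
    show "x + real 2 < foldr turn_lift [Z, X, Y, X, Y] x"
    proof (rule displacement_gt_if_no_fixpoint[where a = a])
      show "continuous_on UNIV (foldr turn_lift [Z, X, Y, X, Y])"
        by (auto simp: o_def intro!: cont continuous_on_turn_lift D)
      show "a + real 2 < foldr turn_lift [Z, X, Y, X, Y] a"
        using turn_lift_bounds(1)[OF D(3), of "2 + a"] by (simp add: XY)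
      show "circ (foldr turn_lift [Z, X, Y, X, Y] x) \<noteq> circ x" for x
        using half_turns_no_fixpoint(2)[OF D ne small] by (simp add: circ)
    qed
  qed
qed

text \<open>A cyclic word of length five either has two equal neighbours, which rotate to the front
  and cancel, or is a proper 3-colouring of the 5-cycle. Such a colouring uses one letter once, with
  the other two alternating.\<close>

lemma advances_words:
  assumes D: "P \<in> diskD" "Q \<in> diskD" "R \<in> diskD" and ne: "P \<noteq> Q" "P \<noteq> R" "Q \<noteq> R"
    and small: "small_triangle P Q R" "small_triangle P R Q" "small_triangle Q R P"
    and letters: "{a, b, c, d, e} \<subseteq> {P, Q, R}"
  shows "advances 2 [a, b, c, d, e]"
proof -
  have disk: "X \<in> diskD" if "X \<in> {P, Q, R}" for X using that D by auto
  have small': "small_triangle X Y Z" if "{X, Y, Z} \<subseteq> {P, Q, R}" "X \<noteq> Y" "Y \<noteq> Z" "X \<noteq> Z" for X Y Z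
    using that small small_triangle_swap by auto
  have three: "advances 1 [x, y, z]" if L: "{x, y, z} \<subseteq> {P, Q, R}" for x y z
  proof -
    have xyz: "x \<in> diskD" "y \<in> diskD" "z \<in> diskD" using L disk by auto
    have rot: "advances 1 [u, v, w] \<Longrightarrow> advances 1 [v, w, u]" if "u \<in> diskD" for u v w
      using advances_rotate[OF that, of 1 "[v, w]"] by simp
    have dup: "advances 1 [u, u, v]" if "u \<in> diskD" "v \<in> diskD" for u v
      using advances_cancel[OF that(1) advances_single[OF that(2)]] by simp
    consider "x = y" | "y = z" | "x = z" | "x \<noteq> y" "y \<noteq> z" "x \<noteq> z" by blast
    then show ?thesis
    proof cases
      case 4
      have "small_triangle y z x" using L 4 by (intro small') auto
      then show ?thesis using advances_alternating(1)[OF xyz(2,3,1)] 4 by simp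
    qed (use xyz dup rot in metis)+
  qed
  have five: "advances 2 [Z, X, Y, X, Y]"
    if "{X, Y, Z} \<subseteq> {P, Q, R}" "X \<noteq> Y" "Y \<noteq> Z" "X \<noteq> Z" for X Y Z
    using advances_alternating(2)[OF disk disk disk that(2) small'[OF that]] that(1) by simp
  have rot: "advances 2 [u, v, w, x, y] \<Longrightarrow> advances 2 [v, w, x, y, u]" if "u \<in> {P, Q, R}" for u v w x y
    using advances_rotate[OF disk[OF that], of 2 "[v, w, x, y]"] by simp
  have dup: "advances 2 [u, u, x, y, z]" if "{u, x, y, z} \<subseteq> {P, Q, R}" for u x y z
    using advances_cancel[OF disk three, of u x y z] that by (simp add: numeral_2_eq_2)
  have L: "a \<in> {P, Q, R}" "b \<in> {P, Q, R}" "c \<in> {P, Q, R}" "d \<in> {P, Q, R}" "e \<in> {P, Q, R}"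
    using letters by auto
  \<comment> \<open>The first five cases locate the equal neighbours, the last five the letter that
    occurs once.\<close>
  consider "a = b" | "b = c" | "c = d" | "d = e" | "e = a"
    | "b = d" "c = e" "a \<noteq> b" "b \<noteq> c" "a \<noteq> c"
    | "c = e" "d = a" "b \<noteq> c" "c \<noteq> d" "b \<noteq> d"
    | "d = a" "e = b" "c \<noteq> d" "d \<noteq> e" "c \<noteq> e"
    | "e = b" "a = c" "d \<noteq> e" "e \<noteq> a" "d \<noteq> a"
    | "a = c" "b = d" "e \<noteq> a" "a \<noteq> b" "e \<noteq> b"
    using L ne by (elim insertE emptyE) simp_all
  then show ?thesis
  proof cases
    case 1
    then show ?thesis using dup L by simp
  next
    case 2
    then have "advances 2 [b, c, d, e, a]" using dup L by simp
    then show ?thesis by (rule rot[OF L(5) rot[OF L(4) rot[OF L(3) rot[OF L(2)]]]])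
  next
    case 3
    then have "advances 2 [c, d, e, a, b]" using dup L by simp
    then show ?thesis by (rule rot[OF L(5) rot[OF L(4) rot[OF L(3)]]])
  next
    case 4
    then have "advances 2 [d, e, a, b, c]" using dup L by simp
    then show ?thesis by (rule rot[OF L(5) rot[OF L(4)]])
  next
    case 5
    then have "advances 2 [e, a, b, c, d]" using dup L by simp
    then show ?thesis by (rule rot[OF L(5)])
  next
    case 6
    then show ?thesis using five[of b c a] L by simp
  next
    case 7
    then have "advances 2 [b, c, d, e, a]" using five[of c d b] L by simp
    then show ?thesis by (rule rot[OF L(5) rot[OF L(4) rot[OF L(3) rot[OF L(2)]]]])
  next
    case 8
    then have "advances 2 [c, d, e, a, b]" using five[of d e c] L by simp
    then show ?thesis by (rule rot[OF L(5) rot[OF L(4) rot[OF L(3)]]])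
  next
    case 9
    then have "advances 2 [d, e, a, b, c]" using five[of e a d] L by simp
    then show ?thesis by (rule rot[OF L(5) rot[OF L(4)]])
  next
    case 10
    then have "advances 2 [e, a, b, c, d]" using five[of a b e] L by simp
    then show ?thesis by (rule rot[OF L(5)])
  qed
qed

theorem theorem6p1:
  fixes P Q R :: complex
  assumes "P \<in> diskD" "Q \<in> diskD" "R \<in> diskD"
    and "\<not> collinear {P, Q, R}"
    and "dK P R = dK Q R"
    and "dK P Q > ln 3"
    and "deltaK P Q R < DeltaK 2 P Q"
  shows "rot_num (psi (convex hull {P, Q, R})) > 2 / 5"
proof -
  let ?F = "tri_lift P Q R"
  note D = assms(1-3)
  have ne: "P \<noteq> Q" "P \<noteq> R" "Q \<noteq> R" using assms(4) by (auto simp: insert_commute)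
  have cont: "continuous_on UNIV ?F"
    unfolding tri_lift_def using D by (intro continuous_on_min continuous_on_turn_lift)
  have lift: "circle_lift (psi (convex hull {P, Q, R})) = ?F"
  proof (rule circle_lift_unique[OF cont])
    show "circ (?F x) = psi (convex hull {P, Q, R}) (circ x)" for x
      by (simp add: psi_triangle[OF D])
    show "0 \<le> ?F 0" "?F 0 < 1"
      using turn_lift_bounds[OF D(1), of 0] turn_lift_bounds[OF D(2), of 0]
        turn_lift_bounds[OF D(3), of 0] by (auto simp: tri_lift_def)
  qed
  have mono: "mono ?F"
    unfolding tri_lift_def using D
    by (intro monoI min.mono) (simp_all add: strict_mono_less_eq strict_mono_turn_lift)
  have shift: "?F (x + 1) = ?F x + 1" for x
    by (simp add: tri_lift_def min_def)
  have "x + 2 < (?F ^^ 5) x" for x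
  proof -
    \<comment> \<open>Each of the five minima is attained at some vertex, so the iterate at
      \<open>x\<close> is a word in the half-turns whose letters may depend on
      \<open>x\<close>.\<close>
    obtain e where e: "e \<in> {P, Q, R}" "?F x = turn_lift e x" using tri_lift_eq by blast
    obtain d where d: "d \<in> {P, Q, R}" "?F (turn_lift e x) = turn_lift d (turn_lift e x)"
      using tri_lift_eq by blast
    obtain c where c: "c \<in> {P, Q, R}" "?F (turn_lift d (turn_lift e x)) = turn_lift c (turn_lift d (turn_lift e x))"
      using tri_lift_eq by blast
    obtain b where b: "b \<in> {P, Q, R}" "?F (turn_lift c (turn_lift d (turn_lift e x)))
        = turn_lift b (turn_lift c (turn_lift d (turn_lift e x)))"
      using tri_lift_eq by blast
    obtain a where a: "a \<in> {P, Q, R}" "?F (turn_lift b (turn_lift c (turn_lift d (turn_lift e x))))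
        = turn_lift a (turn_lift b (turn_lift c (turn_lift d (turn_lift e x))))"
      using tri_lift_eq by blast
    have "advances 2 [a, b, c, d, e]"
      using advances_words[OF D ne small_triangle_all[OF assms]] a b c d e by simp
    then show ?thesis
      by (simp add: advances_def eval_nat_numeral a b c d e)
  qed
  then have "lim (\<lambda>n. (?F ^^ n) 0 / real n) > 2 / real 5"
    by (intro rotation_gt[of ?F, OF mono shift cont]) auto
  then show ?thesis by (simp add: rot_num_def lift)
qed

end
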